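(* Let $n$ be a nonnegative integer and let $x$ and $z$ be two complex numbers with $z\notin\{-1/2,1/2,\ldots,n-1/2\}$. Then $$\sum_{k=0}^n \binom{z+1/2}{k} (-1)^k (1+x)^k= (-1)^n\, 2(n+1) \binom{z+1/2}{n+1}\sum_{k=0}^n \binom{n}{k} \frac{x^k}{2z-2k+1}.$$
   Context: For a complex number $w$ and an integer $k\ge 0$, $\binom{w}{k}=\frac{w(w-1)\cdots(w-k+1)}{k!}$ (with $\binom{w}{0}=1$). The convention $0^0=1$ is used. The excluded set $\{-1/2,1/2,\ldots,n-1/2\}$ is $\{j-1/2 : j=0,1,\ldots,n\}$. *)

theory Defs
  imports Complex_Main
begin

end

theory Submission
  imports Defs
begin

text \<open>
  Put \<open>w = z + 1/2\<close>, so that \<open>2z - 2k + 1 = 2(w - k)\<close>; the factors 2 cancel, and the right-hand side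
  becomes \<open>T n = (-1)^n (n+1) (w gchoose (n+1)) R n\<close> with
  \<open>R n = (\<Sum>k\<le>n. (n choose k) x^k / (w - k))\<close>. It suffices that \<open>T\<close> telescopes to the left-hand side:
  \<open>T 0 = 1\<close>, and \<open>T (n+1) - T n\<close> is the summand of index \<open>n+1\<close>.

  The increment comes from a recurrence for \<open>R\<close>. Writing \<open>(w - n) / (w - k) = 1 - (n - k) / (w - k)\<close>
  splits \<open>(w - n) R n\<close> into the binomial expansion of \<open>(1 + x)^n\<close> and, by absorption
  \<open>(n - k) (n choose k) = n ((n-1) choose k)\<close>, the term \<open>n R (n-1)\<close>. Since
  \<open>(n+1) (w gchoose (n+1)) = (w - n) (w gchoose n)\<close>, the factor \<open>w - n\<close> needed for this splitting is
  already present in \<open>T n\<close>.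
\<close>

text \<open>
  Write \<open>R n\<close> for the sum on the right. For complex \<open>w\<close> of real part above \<open>n\<close>, each \<open>1 / (w - k)\<close>
  is the integral of \<open>t^(w-k-1)\<close> over \<open>[0, 1]\<close>, so \<open>R n\<close> is the integral of \<open>t^(w-n-1) (x + t)^n\<close>,
  and for real part above \<open>n+1\<close> the recurrence is integration by parts. Over a field of
  characteristic 0, the termwise splitting of \<open>(w - (n+1)) / (w - k)\<close> takes its place.
\<close>
lemma binomial_partial_fraction_recurrence:
  fixes w x :: "'a :: field_char_0"
  assumes w: "\<And>k. k \<le> Suc n \<Longrightarrow> w \<noteq> of_nat k"
  shows "(w - of_nat (Suc n)) * (\<Sum>k\<le>Suc n. of_nat (Suc n choose k) * x ^ k / (w - of_nat k)) =
    (1 + x) ^ Suc n - of_nat (Suc n) * (\<Sum>k\<le>n. of_nat (n choose k) * x ^ k / (w - of_nat k))"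
proof -
  have split: "(w - of_nat (Suc n)) * (of_nat (Suc n choose k) * x ^ k / (w - of_nat k)) =
      of_nat (Suc n choose k) * x ^ k
        - of_nat (Suc n) * (of_nat (n choose k) * x ^ k / (w - of_nat k))"
    if k: "k \<le> Suc n" for k
  proof -
    have "(Suc n - k) * (Suc n choose k) = Suc n * (n choose k)"
      using binomial_absorb_comp[of "Suc n" k] by simp
    then have absorb: "(of_nat (Suc n) - of_nat k) * of_nat (Suc n choose k) =
        of_nat (Suc n) * (of_nat (n choose k) :: 'a)"
      using k by (metis of_nat_diff of_nat_mult)
    have nz: "w - of_nat k \<noteq> 0"
      using w[OF k] by simp
    have "(w - of_nat (Suc n)) * (of_nat (Suc n choose k) * x ^ k / (w - of_nat k)) =
        ((w - of_nat k) - (of_nat (Suc n) - of_nat k)) * of_nat (Suc n choose k) * x ^ k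
          / (w - of_nat k)"
      by simp
    also have "\<dots> = ((w - of_nat k) * of_nat (Suc n choose k)
        - of_nat (Suc n) * of_nat (n choose k)) * x ^ k / (w - of_nat k)"
      by (simp only: left_diff_distrib[of "w - of_nat k"] absorb)
    also have "\<dots> = of_nat (Suc n choose k) * x ^ k
        - of_nat (Suc n) * (of_nat (n choose k) * x ^ k / (w - of_nat k))"
      by (simp only: left_diff_distrib[of "(w - of_nat k) * _"] diff_divide_distrib mult.assoc
          nonzero_mult_div_cancel_left[OF nz] times_divide_eq_right)
    finally show ?thesis .
  qed
  have "(\<Sum>k\<le>Suc n. (w - of_nat (Suc n)) * (of_nat (Suc n choose k) * x ^ k / (w - of_nat k))) =
      (\<Sum>k\<le>Suc n. of_nat (Suc n choose k) * x ^ k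
        - of_nat (Suc n) * (of_nat (n choose k) * x ^ k / (w - of_nat k)))"
    using split by (intro sum.cong) auto
  also have "\<dots> = (\<Sum>k\<le>Suc n. of_nat (Suc n choose k) * x ^ k)
      - of_nat (Suc n) * (\<Sum>k\<le>Suc n. of_nat (n choose k) * x ^ k / (w - of_nat k))"
    by (simp only: sum_subtractf sum_distrib_left)
  also have "(\<Sum>k\<le>Suc n. of_nat (Suc n choose k) * x ^ k) = (1 + x) ^ Suc n"
    using binomial_ring[of x 1 "Suc n"] by (simp only: power_one mult_1_right add.commute)
  also have "(\<Sum>k\<le>Suc n. of_nat (n choose k) * x ^ k / (w - of_nat k)) =
      (\<Sum>k\<le>n. of_nat (n choose k) * x ^ k / (w - of_nat k))"
    by simp
  finally show ?thesis
    by (simp only: sum_distrib_left)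
qed

text \<open>
  The factor \<open>(w - (n+1)) (w gchoose (n+1))\<close> of the right-hand side at \<open>n+1\<close> is what the recurrence
  consumes; the opposite signs \<open>(-1)^(n+1)\<close> and \<open>-(n+1) R n\<close> then return exactly the right-hand side
  at \<open>n\<close> beside the new summand.
\<close>
lemma alternating_gbinomial_sum_partial_fractions:
  fixes w x :: "'a :: field_char_0"
  assumes "\<And>k. k \<le> n \<Longrightarrow> w \<noteq> of_nat k"
  shows "(\<Sum>k\<le>n. (w gchoose k) * (-1) ^ k * (1 + x) ^ k) =
    (-1) ^ n * of_nat (Suc n) * (w gchoose Suc n) *
      (\<Sum>k\<le>n. of_nat (n choose k) * x ^ k / (w - of_nat k))"
  using assms
proof (induction n)
  case 0
  then show ?case by simp
next
  case (Suc n)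
  define R where "R m = (\<Sum>k\<le>m. of_nat (m choose k) * x ^ k / (w - of_nat k))" for m
  let ?m = "Suc n"
  have IH: "(\<Sum>k\<le>n. (w gchoose k) * (-1) ^ k * (1 + x) ^ k) =
      (-1) ^ n * of_nat ?m * (w gchoose ?m) * R n"
    using Suc unfolding R_def by simp
  have rec: "(w - of_nat ?m) * R ?m = (1 + x) ^ ?m - of_nat ?m * R n"
    unfolding R_def using Suc.prems by (rule binomial_partial_fraction_recurrence)
  have absorb: "of_nat (Suc ?m) * (w gchoose Suc ?m) = (w - of_nat ?m) * (w gchoose ?m)"
    using gbinomial_absorb_comp[of w ?m] gbinomial_absorption[of ?m w] by simp
  have "(-1) ^ ?m * of_nat (Suc ?m) * (w gchoose Suc ?m) * R ?m =
      (-1) ^ ?m * (of_nat (Suc ?m) * (w gchoose Suc ?m)) * R ?m"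
    by (simp only: mult.assoc)
  also have "\<dots> = (-1) ^ ?m * (w gchoose ?m) * ((w - of_nat ?m) * R ?m)"
    by (simp only: absorb mult.assoc mult.left_commute mult.commute)
  also have "\<dots> = (w gchoose ?m) * (-1) ^ ?m * (1 + x) ^ ?m
      + (-1) ^ n * of_nat ?m * (w gchoose ?m) * R n"
    unfolding rec by (simp add: algebra_simps)
  also have "\<dots> = (\<Sum>k\<le>?m. (w gchoose k) * (-1) ^ k * (1 + x) ^ k)"
    using IH by simp
  finally show ?case
    unfolding R_def by (rule sym)
qed

theorem proposition3p1:
  fixes n :: nat and x z :: complex
  assumes "z \<notin> {of_nat j - 1/2 | j. j \<le> n}"
  shows "(\<Sum>k=0..n. ((z + 1/2) gchoose k) * (-1) ^ k * (1 + x) ^ k) =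
    (-1) ^ n * 2 * (of_nat n + 1) * ((z + 1/2) gchoose (n + 1)) *
      (\<Sum>k=0..n. of_nat (n choose k) * (x ^ k / (2 * z - 2 * of_nat k + 1)))"
proof -
  let ?w = "z + 1/2"
  have w: "?w \<noteq> of_nat k" if "k \<le> n" for k
    using assms that by (auto simp: eq_diff_eq)
  have half: "of_nat (n choose k) * x ^ k / (?w - of_nat k) =
      2 * (of_nat (n choose k) * (x ^ k / (2 * z - 2 * of_nat k + 1)))" for k
  proof -
    have "2 * z - 2 * of_nat k + 1 = 2 * (?w - of_nat k)"
      by (simp add: algebra_simps)
    then show ?thesis
      by (simp only: times_divide_eq_right mult_divide_mult_cancel_left_if) simp
  qed
  show ?thesis
    using alternating_gbinomial_sum_partial_fractions[of n ?w x, OF w]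
    unfolding half sum_distrib_left[symmetric]
    by (simp add: atLeast0AtMost ac_simps)
qed

end
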